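(* Let $1\le r_1,r_2\le n$, $s_1,s_2\ge 1$, and put $\mathbf r=\min\{r_1,r_2\}$, $\mathbf{\tilde r}=\max\{r_1,r_2\}$, $\mathbf k=\min\{\mathbf r-1,\,n-\mathbf{\tilde r}\}$. Let $\sigma:B^{r_1,s_1}\otimes B^{r_2,s_2}\to B^{r_2,s_2}\otimes B^{r_1,s_1}$ be the combinatorial $R$-matrix and let $A\otimes B$ be a classical highest weight element of $B^{r_1,s_1}\otimes B^{r_2,s_2}$, $A=(a_{p,q})$. Then $\sigma(A\otimes B)=\widetilde A\otimes\widetilde B$, $\widetilde A=(\widetilde a_{p,q})$, is the unique classical highest weight element of $B^{r_2,s_2}\otimes B^{r_1,s_1}$ with $$\widetilde B=0\quad\text{and}\quad \widetilde a_{\mathbf r-j,\mathbf{\tilde r}+j}=a_{\mathbf r-j,\mathbf{\tilde r}+j}\ \text{ for all } j=0,1,\dots,\mathbf k.$$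
   Context: Let $n\ge 1$, $I=\{0,1,\dots,n\}$, $I_0=\{1,\dots,n\}$ (affine type $A_n^{(1)}$); let $\alpha_l,\omega_l$ ($l\in I_0$) be the simple roots and fundamental weights of type $A_n$ and $\alpha_{p,q}=\alpha_p+\alpha_{p+1}+\cdots+\alpha_q$ for $1\le p\le q\le n$. The crystal $B^{i,m}$ ($1\le i\le n$, $m\ge1$). It is the set of arrays $A=(a_{p,q})_{1\le p\le i,\ i\le q\le n}$ of non-negative integers ($p$ is the column index, $q$ the row index) such that $\sum_{s=1}^n a_{\beta(s)}\le m$ for every sequence $(\beta(1),\dots,\beta(n))$ with $\beta(1)=(1,i)$, $\beta(n)=(i,n)$ and such that $\beta(s)=(p,q)$ implies $\beta(s+1)\in\{(p,q+1),(p+1,q)\}$. The weight is $\mathrm{wt}(A)=m\omega_i-\sum_{1\le p\le i\le q\le n}a_{p,q}\alpha_{p,q}$. The array with all entries zero is denoted $0$ (not to be confused with the symbol $0$ used when a Kashiwara operator annihilates an element). For $l>i$ let $F_l(p)=\sum_{j=1}^p a_{j,l-1}+\sum_{j=p}^i a_{j,l}$ ($1\le p\le i$), and let $p^l_+(A)$ (resp. $q^l_+(A)$) be the smallest (resp. largest) $p$ at which $F_l$ attains its maximum. For $1\le l<i$ let $G_l(p)=\sum_{j=i}^p a_{l,j}+\sum_{j=p}^n a_{l+1,j}$ ($i\le p\le n$), and let $p^l_-(A)$ (resp. $q^l_-(A)$) be the largest (resp. smallest) $p$ at which $G_l$ attains its maximum. Set $\varphi_i(A)=m-\sum_{j=1}^{i-1}a_{j,i}-\sum_{j=i}^n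 a_{i,j}$; $\varphi_l(A)=\sum_{j=1}^{p^l_+(A)}a_{j,l-1}-\sum_{j=1}^{p^l_+(A)-1}a_{j,l}$ for $l>i$; $\varphi_l(A)=\sum_{j=p^l_-(A)}^n a_{l+1,j}-\sum_{j=p^l_-(A)+1}^n a_{l,j}$ for $1\le l<i$; $\varphi_0(A)=a_{1,n}$; $\epsilon_i(A)=a_{i,i}$; $\epsilon_l(A)=\sum_{j=q^l_+(A)}^i a_{j,l}-\sum_{j=q^l_+(A)+1}^i a_{j,l-1}$ for $l>i$; $\epsilon_l(A)=\sum_{j=i}^{q^l_-(A)}a_{l,j}-\sum_{j=i}^{q^l_-(A)-1}a_{l+1,j}$ for $1\le l<i$; $\epsilon_0(A)=m-\sum_{j=i}^n a_{1,j}-\sum_{j=2}^i a_{j,n}$. For $l\in I$, $\tilde f_lA=0$ if $\varphi_l(A)=0$, and otherwise $\tilde f_l$ acts by: $l=0$: $a_{1,n}\mapsto a_{1,n}-1$; $l=i$: $a_{i,i}\mapsto a_{i,i}+1$; $l>i$: with $p=p^l_+(A)$, $a_{p,l-1}\mapsto a_{p,l-1}-1$ and $a_{p,l}\mapsto a_{p,l}+1$; $1\le l<i$: with $p=p^l_-(A)$, $a_{l,p}\mapsto a_{l,p}+1$ and $a_{l+1,p}\mapsto a_{l+1,p}-1$. Likewise $\tilde e_lA=0$ if $\epsilon_l(A)=0$, and otherwise: $l=0$: $a_{1,n}\mapsto a_{1,n}+1$; $l=i$: $a_{i,i}\mapsto a_{i,i}-1$; $l>i$: with $q=q^l_+(A)$,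 $a_{q,l-1}\mapsto a_{q,l-1}+1$ and $a_{q,l}\mapsto a_{q,l}-1$; $1\le l<i$: with $q=q^l_-(A)$, $a_{l,q}\mapsto a_{l,q}-1$ and $a_{l+1,q}\mapsto a_{l+1,q}+1$. With this structure $B^{i,m}$ is a realization of the Kirillov--Reshetikhin crystal. Tensor products. $B_1\otimes B_2$ is the set $B_1\times B_2$ with: $\tilde f_l(b_1\otimes b_2)=(\tilde f_lb_1)\otimes b_2$ if $\epsilon_l(b_1)\ge\varphi_l(b_2)$ and $b_1\otimes(\tilde f_lb_2)$ otherwise; $\tilde e_l(b_1\otimes b_2)=(\tilde e_lb_1)\otimes b_2$ if $\epsilon_l(b_1)>\varphi_l(b_2)$ and $b_1\otimes(\tilde e_lb_2)$ otherwise; $\mathrm{wt}(b_1\otimes b_2)=\mathrm{wt}(b_1)+\mathrm{wt}(b_2)$; $\varphi_l(b_1\otimes b_2)=\max\{\varphi_l(b_1),\varphi_l(b_1)+\varphi_l(b_2)-\epsilon_l(b_1)\}$; $\epsilon_l(b_1\otimes b_2)=\max\{\epsilon_l(b_2),\epsilon_l(b_1)+\epsilon_l(b_2)-\varphi_l(b_2)\}$. An element is a (classical) highest weight element if it is annihilated by $\tilde e_l$ for all $l\in I_0$. The combinatorial $R$-matrix $\sigma:B^{r_1,s_1}\otimes B^{r_2,s_2}\to B^{r_2,s_2}\otimes B^{r_1,s_1}$ is the unique isomorphism of affine crystals (bijection preserving $\mathrm{wt},\epsilon_l,\varphi_l$ and commuting with $\tilde e_l,\tilde f_l$ for all $l\in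 I$); it is known to exist and it satisfies $\sigma(0\otimes0)=0\otimes0$. *)

theory Defs
  imports Main
begin

text \<open>
  Crystals are given by their data only.  \<open>None\<close> is the symbol \<open>0\<close> to which a Kashiwara operator
  sends an annihilated element.  A weight \<open>\<lambda>\<close> of type \<open>A\<^sub>n\<close> is the function \<open>l \<mapsto> \<langle>h\<^sub>l, \<lambda>\<rangle>\<close>, i.e. its
  coordinates in the basis of fundamental weights \<open>\<omega>\<^sub>1, \<dots>, \<omega>\<^sub>n\<close>, extended by \<open>0\<close>.
\<close>

type_synonym weight = "nat \<Rightarrow> int"

record 'b crystal =
  elems :: "'b set"
  wt    :: "'b \<Rightarrow> weight"
  kash_e :: "nat \<Rightarrow> 'b \<Rightarrow> 'b option"
  kash_f :: "nat \<Rightarrow> 'b \<Rightarrow> 'b option"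
  eps   :: "nat \<Rightarrow> 'b \<Rightarrow> int"
  phi   :: "nat \<Rightarrow> 'b \<Rightarrow> int"

definition fund_weight :: "nat \<Rightarrow> weight" where
  "fund_weight i = (\<lambda>l. if l = i then 1 else 0)"

definition simple_root :: "nat \<Rightarrow> nat \<Rightarrow> weight" where
  "simple_root n i = (\<lambda>l. if l \<notin> {1..n} then 0
      else if l = i then 2 else if l = i + 1 \<or> i = l + 1 then -1 else 0)"

definition pos_root :: "nat \<Rightarrow> nat \<Rightarrow> nat \<Rightarrow> weight" where
  "pos_root n p q = (\<lambda>l. \<Sum>k = p..q. simple_root n k l)"

definition tensor :: "'b crystal \<Rightarrow> 'c crystal \<Rightarrow> ('b \<times> 'c) crystal" (infixr \<open>\<otimes>\<^sub>c\<close> 70) where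
  "B1 \<otimes>\<^sub>c B2 = \<lparr>
     elems = elems B1 \<times> elems B2,
     wt = (\<lambda>(b1, b2) l. wt B1 b1 l + wt B2 b2 l),
     kash_e = (\<lambda>l (b1, b2).
        if eps B1 l b1 > phi B2 l b2 then map_option (\<lambda>b. (b, b2)) (kash_e B1 l b1)
        else map_option (\<lambda>b. (b1, b)) (kash_e B2 l b2)),
     kash_f = (\<lambda>l (b1, b2).
        if eps B1 l b1 \<ge> phi B2 l b2 then map_option (\<lambda>b. (b, b2)) (kash_f B1 l b1)
        else map_option (\<lambda>b. (b1, b)) (kash_f B2 l b2)),
     eps = (\<lambda>l (b1, b2). max (eps B2 l b2) (eps B1 l b1 + eps B2 l b2 - phi B2 l b2)),
     phi = (\<lambda>l (b1, b2). max (phi B1 l b1) (phi B1 l b1 + phi B2 l b2 - eps B1 l b1))\<rparr>"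

definition affine_crystal_iso :: "nat \<Rightarrow> 'b crystal \<Rightarrow> 'c crystal \<Rightarrow> ('b \<Rightarrow> 'c) \<Rightarrow> bool" where
  "affine_crystal_iso n B C \<sigma> \<longleftrightarrow>
     bij_betw \<sigma> (elems B) (elems C) \<and>
     (\<forall>b \<in> elems B. wt C (\<sigma> b) = wt B b \<and>
        (\<forall>l \<in> {0..n}.
           eps C l (\<sigma> b) = eps B l b \<and> phi C l (\<sigma> b) = phi B l b \<and>
           kash_e C l (\<sigma> b) = map_option \<sigma> (kash_e B l b) \<and>
           kash_f C l (\<sigma> b) = map_option \<sigma> (kash_f B l b)))"

definition classical_highest_weight :: "nat \<Rightarrow> 'b crystal \<Rightarrow> 'b \<Rightarrow> bool" where
  "classical_highest_weight n B b \<longleftrightarrow> b \<in> elems B \<and> (\<forall>l \<in> {1..n}. kash_e B l b = None)"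

text \<open>
  An array is a function of the column \<open>p\<close> and the row \<open>q\<close>; it vanishes outside
  \<open>1 \<le> p \<le> i \<le> q \<le> n\<close>, so that equality of functions is equality of arrays.
\<close>

type_synonym arr = "nat \<Rightarrow> nat \<Rightarrow> nat"

definition zero_arr :: arr where
  "zero_arr = (\<lambda>p q. 0)"

definition KR_path :: "nat \<Rightarrow> nat \<Rightarrow> (nat \<Rightarrow> nat \<times> nat) \<Rightarrow> bool" where
  "KR_path n i \<beta> \<longleftrightarrow> \<beta> 1 = (1, i) \<and> \<beta> n = (i, n) \<and>
     (\<forall>s \<in> {1..<n}. \<forall>p q. \<beta> s = (p, q) \<longrightarrow> \<beta> (s + 1) \<in> {(p, q + 1), (p + 1, q)})"

definition KR_set :: "nat \<Rightarrow> nat \<Rightarrow> nat \<Rightarrow> arr set" where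
  "KR_set n i m = {a.
     (\<forall>p q. \<not> (1 \<le> p \<and> p \<le> i \<and> i \<le> q \<and> q \<le> n) \<longrightarrow> a p q = 0) \<and>
     (\<forall>\<beta>. KR_path n i \<beta> \<longrightarrow> (\<Sum>s = 1..n. case \<beta> s of (p, q) \<Rightarrow> a p q) \<le> m)}"

definition KR_wt :: "nat \<Rightarrow> nat \<Rightarrow> nat \<Rightarrow> arr \<Rightarrow> weight" where
  "KR_wt n i m a = (\<lambda>l. int m * fund_weight i l
     - (\<Sum>p = 1..i. \<Sum>q = i..n. int (a p q) * pos_root n p q l))"

definition maximizers :: "(nat \<Rightarrow> nat) \<Rightarrow> nat set \<Rightarrow> nat set" where
  "maximizers F S = {p. is_arg_max F (\<lambda>p. p \<in> S) p}"

definition F_fun :: "nat \<Rightarrow> arr \<Rightarrow> nat \<Rightarrow> nat \<Rightarrow> nat" where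
  "F_fun i a l p = (\<Sum>j = 1..p. a j (l - 1)) + (\<Sum>j = p..i. a j l)"

definition G_fun :: "nat \<Rightarrow> nat \<Rightarrow> arr \<Rightarrow> nat \<Rightarrow> nat \<Rightarrow> nat" where
  "G_fun n i a l p = (\<Sum>j = i..p. a l j) + (\<Sum>j = p..n. a (l + 1) j)"

definition p_plus :: "nat \<Rightarrow> arr \<Rightarrow> nat \<Rightarrow> nat" where
  "p_plus i a l = Min (maximizers (F_fun i a l) {1..i})"

definition q_plus :: "nat \<Rightarrow> arr \<Rightarrow> nat \<Rightarrow> nat" where
  "q_plus i a l = Max (maximizers (F_fun i a l) {1..i})"

definition p_minus :: "nat \<Rightarrow> nat \<Rightarrow> arr \<Rightarrow> nat \<Rightarrow> nat" where
  "p_minus n i a l = Max (maximizers (G_fun n i a l) {i..n})"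

definition q_minus :: "nat \<Rightarrow> nat \<Rightarrow> arr \<Rightarrow> nat \<Rightarrow> nat" where
  "q_minus n i a l = Min (maximizers (G_fun n i a l) {i..n})"

definition KR_phi :: "nat \<Rightarrow> nat \<Rightarrow> nat \<Rightarrow> nat \<Rightarrow> arr \<Rightarrow> int" where
  "KR_phi n i m l a =
     (if l = 0 then int (a 1 n)
      else if l = i then
        int m - (\<Sum>j \<in> {1..<i}. int (a j i)) - (\<Sum>j = i..n. int (a i j))
      else if l > i then
        (\<Sum>j = 1..p_plus i a l. int (a j (l - 1))) - (\<Sum>j \<in> {1..<p_plus i a l}. int (a j l))
      else
        (\<Sum>j = p_minus n i a l..n. int (a (l + 1) j))
          - (\<Sum>j = p_minus n i a l + 1..n. int (a l j)))"

definition KR_eps :: "nat \<Rightarrow> nat \<Rightarrow> nat \<Rightarrow> nat \<Rightarrow> arr \<Rightarrow> int" where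
  "KR_eps n i m l a =
     (if l = 0 then
        int m - (\<Sum>j = i..n. int (a 1 j)) - (\<Sum>j = 2..i. int (a j n))
      else if l = i then int (a i i)
      else if l > i then
        (\<Sum>j = q_plus i a l..i. int (a j l)) - (\<Sum>j = q_plus i a l + 1..i. int (a j (l - 1)))
      else
        (\<Sum>j = i..q_minus n i a l. int (a l j))
          - (\<Sum>j \<in> {i..<q_minus n i a l}. int (a (l + 1) j)))"

definition incr :: "nat \<Rightarrow> nat \<Rightarrow> arr \<Rightarrow> arr" where
  "incr p q a = a(p := (a p)(q := a p q + 1))"

text \<open>
  Truncated subtraction is harmless: below, \<open>decr\<close> is only applied when \<open>\<phi>\<^sub>l\<close> (for \<open>f\<^sub>l\<close>) or
  \<open>\<epsilon>\<^sub>l\<close> (for \<open>e\<^sub>l\<close>) is nonzero, and on elements of the crystal this makes the entry positive.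
\<close>

definition decr :: "nat \<Rightarrow> nat \<Rightarrow> arr \<Rightarrow> arr" where
  "decr p q a = a(p := (a p)(q := a p q - 1))"

definition KR_f :: "nat \<Rightarrow> nat \<Rightarrow> nat \<Rightarrow> nat \<Rightarrow> arr \<Rightarrow> arr option" where
  "KR_f n i m l a =
     (if KR_phi n i m l a = 0 then None
      else Some
        (if l = 0 then decr 1 n a
         else if l = i then incr i i a
         else if l > i then incr (p_plus i a l) l (decr (p_plus i a l) (l - 1) a)
         else incr l (p_minus n i a l) (decr (l + 1) (p_minus n i a l) a)))"

definition KR_e :: "nat \<Rightarrow> nat \<Rightarrow> nat \<Rightarrow> nat \<Rightarrow> arr \<Rightarrow> arr option" where
  "KR_e n i m l a =
     (if KR_eps n i m l a = 0 then None
      else Some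
        (if l = 0 then incr 1 n a
         else if l = i then decr i i a
         else if l > i then incr (q_plus i a l) (l - 1) (decr (q_plus i a l) l a)
         else incr (l + 1) (q_minus n i a l) (decr l (q_minus n i a l) a)))"

definition KR_crystal :: "nat \<Rightarrow> nat \<Rightarrow> nat \<Rightarrow> arr crystal" where
  "KR_crystal n i m = \<lparr>
     elems = KR_set n i m,
     wt = KR_wt n i m,
     kash_e = KR_e n i m,
     kash_f = KR_f n i m,
     eps = KR_eps n i m,
     phi = KR_phi n i m\<rparr>"

text \<open>
  The combinatorial \<open>R\<close>-matrix is the unique affine crystal isomorphism between the two tensor
  products.  Only the isomorphism property is recorded, so a statement about every \<open>\<sigma>\<close> with this
  property does not presuppose uniqueness.
\<close>

definition combinatorial_R ::
  "nat \<Rightarrow> nat \<Rightarrow> nat \<Rightarrow> nat \<Rightarrow> nat \<Rightarrow> (arr \<times> arr \<Rightarrow> arr \<times> arr) \<Rightarrow> bool" where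
  "combinatorial_R n r1 s1 r2 s2 \<sigma> \<longleftrightarrow>
     affine_crystal_iso n
       (KR_crystal n r1 s1 \<otimes>\<^sub>c KR_crystal n r2 s2)
       (KR_crystal n r2 s2 \<otimes>\<^sub>c KR_crystal n r1 s1) \<sigma>"

end

theory Submission
  imports Defs
begin

text \<open>
  Raising an element \<open>A \<otimes> B\<close> acts on \<open>B\<close> unless \<open>\<epsilon>\<^sub>l(A) > \<phi>\<^sub>l(B)\<close>, so \<open>A \<otimes> B\<close> is a classical
  highest weight element only if \<open>\<epsilon>\<^sub>l(B) = 0\<close> and \<open>\<epsilon>\<^sub>l(A) \<le> \<phi>\<^sub>l(B)\<close> for all \<open>l \<in> {1..n}\<close>. In
  \<open>B\<^sup>i\<^sup>,\<^sup>m\<close> the number \<open>\<epsilon>\<^sub>l\<close> is a maximum of differences of partial sums over two adjacent rows or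
  columns, hence its vanishing is a system of inequalities that bound an entry by entries nearer to
  the corner \<open>(i, i)\<close>. Solving this system from the corner outwards (\<open>eps_zero_support\<close>) shows that
  an array with \<open>\<epsilon>\<^sub>l = 0\<close> for all \<open>l \<noteq> t\<close> lives on the antidiagonal \<open>p + q = i + t\<close>. For \<open>t = 0\<close>
  this antidiagonal misses the array, which gives \<open>B = 0\<close>; then \<open>\<phi>\<^sub>l(B) = 0\<close> for \<open>l \<noteq> r\<^sub>2\<close>, and
  \<open>t = r\<^sub>2\<close> confines \<open>A\<close> to \<open>p + q = r\<^sub>1 + r\<^sub>2\<close>.

  This description is symmetric in \<open>r\<^sub>1\<close> and \<open>r\<^sub>2\<close>, and \<open>\<sigma>\<close> preserves highest weight elements. So
  \<open>A\<close> and \<open>A~\<close>, the first factor of \<open>\<sigma>(A \<otimes> B)\<close>, are supported on one and the same antidiagonal, and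
  an array of this kind is known once its entries there are; this is the uniqueness claim. The
  entries are compared through \<open>\<phi>\<^sub>l - \<epsilon>\<^sub>l\<close>, which \<open>\<sigma>\<close> preserves and which is additive on tensor
  products. For \<open>l > max r\<^sub>1 r\<^sub>2\<close> it is the difference of two consecutive antidiagonal entries, and for
  \<open>l = max r\<^sub>1 r\<^sub>2\<close> it yields the first one, by formulas symmetric in the two factors. Hence all
  antidiagonal entries of \<open>A\<close> and \<open>A~\<close> agree (and in fact \<open>A~ = A\<close>).
\<close>

section \<open>String lengths as maxima\<close>

lemma is_maximizer:
  assumes "finite S" "S \<noteq> {}" "x = Min (maximizers F S) \<or> x = Max (maximizers F S)"
  shows "x \<in> S" and "y \<in> S \<Longrightarrow> F y \<le> F x"
proof -
  have fin: "finite (maximizers F S)"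
    using assms(1) by (rule rev_finite_subset) (auto simp: maximizers_def is_arg_max_def)
  have "Max (F ` S) \<in> F ` S"
    using assms by simp
  then obtain z where z: "z \<in> S" "F z = Max (F ` S)"
    by auto
  have "F y \<le> F z" if "y \<in> S" for y
    using that z assms(1) by simp
  then have "z \<in> maximizers F S"
    using z(1) by (auto simp: maximizers_def is_arg_max_def not_less)
  then have "x \<in> maximizers F S"
    using fin assms(3) Min_in Max_in by blast
  then show "x \<in> S" and "y \<in> S \<Longrightarrow> F y \<le> F x"
    by (auto simp: maximizers_def is_arg_max_def not_less)
qed

lemma sum_split_at:
  fixes f :: "nat \<Rightarrow> int"
  assumes "b \<le> p" "p \<le> c"
  shows "(\<Sum>j = b..p. f j) + (\<Sum>j = p + 1..c. f j) = (\<Sum>j = b..c. f j)"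
    and "(\<Sum>j \<in> {b..<p}. f j) + (\<Sum>j = p..c. f j) = (\<Sum>j = b..c. f j)"
proof -
  have "{b..c} = {b..p} \<union> {p + 1..c}"
    using assms by auto
  then show "(\<Sum>j = b..p. f j) + (\<Sum>j = p + 1..c. f j) = (\<Sum>j = b..c. f j)"
    using sum.union_disjoint[of "{b..p}" "{p + 1..c}" f] by simp
  have "{b..c} = {b..<p} \<union> {p..c}"
    using assms by auto
  then show "(\<Sum>j \<in> {b..<p}. f j) + (\<Sum>j = p..c. f j) = (\<Sum>j = b..c. f j)"
    using sum.union_disjoint[of "{b..<p}" "{p..c}" f] by (simp add: ivl_disj_int)
qed

lemma int_F_fun: "int (F_fun i a l p) = (\<Sum>j = 1..p. int (a j (l - 1))) + (\<Sum>j = p..i. int (a j l))"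
  by (simp add: F_fun_def)

lemma int_G_fun: "int (G_fun n i a l p) = (\<Sum>j = i..p. int (a l j)) + (\<Sum>j = p..n. int (a (l + 1) j))"
  by (simp add: G_fun_def)

text \<open>
  Completing the partial sums to full rows or columns turns \<open>\<epsilon>\<^sub>l\<close> and \<open>\<phi>\<^sub>l\<close> into the maximum of
  \<open>F\<^sub>l\<close> (or \<open>G\<^sub>l\<close>) minus a quantity that does not depend on the maximizer.
\<close>

lemma eps_row:
  assumes "i < l" "1 \<le> i"
  shows "KR_eps n i m l a = int (F_fun i a l (q_plus i a l)) - (\<Sum>j = 1..i. int (a j (l - 1)))"
proof -
  have "q_plus i a l \<in> {1..i}"
    unfolding q_plus_def using assms by (intro is_maximizer(1)) auto
  then show ?thesis
    using assms sum_split_at(1)[of 1 "q_plus i a l" i "\<lambda>j. int (a j (l - 1))"]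
    unfolding int_F_fun by (simp add: KR_eps_def)
qed

lemma phi_row:
  assumes "i < l" "1 \<le> i"
  shows "KR_phi n i m l a = int (F_fun i a l (p_plus i a l)) - (\<Sum>j = 1..i. int (a j l))"
proof -
  have "p_plus i a l \<in> {1..i}"
    unfolding p_plus_def using assms by (intro is_maximizer(1)) auto
  then show ?thesis
    using assms sum_split_at(2)[of 1 "p_plus i a l" i "\<lambda>j. int (a j l)"]
    unfolding int_F_fun by (simp add: KR_phi_def)
qed

lemma eps_column:
  assumes "1 \<le> l" "l < i" "i \<le> n"
  shows "KR_eps n i m l a = int (G_fun n i a l (q_minus n i a l)) - (\<Sum>j = i..n. int (a (l + 1) j))"
proof -
  have "q_minus n i a l \<in> {i..n}"
    unfolding q_minus_def using assms by (intro is_maximizer(1)) auto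
  then show ?thesis
    using assms sum_split_at(2)[of i "q_minus n i a l" n "\<lambda>j. int (a (l + 1) j)"]
    unfolding int_G_fun by (simp add: KR_eps_def)
qed

lemma phi_column:
  assumes "1 \<le> l" "l < i" "i \<le> n"
  shows "KR_phi n i m l a = int (G_fun n i a l (p_minus n i a l)) - (\<Sum>j = i..n. int (a l j))"
proof -
  have "p_minus n i a l \<in> {i..n}"
    unfolding p_minus_def using assms by (intro is_maximizer(1)) auto
  then show ?thesis
    using assms sum_split_at(1)[of i "p_minus n i a l" n "\<lambda>j. int (a l j)"]
    unfolding int_G_fun by (simp add: KR_phi_def)
qed

lemma eps_row_ge:
  assumes "1 \<le> p" "p \<le> i" "i < l"
  shows "(\<Sum>j = p..i. int (a j l)) - (\<Sum>j = p + 1..i. int (a j (l - 1))) \<le> KR_eps n i m l a"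
proof -
  have "F_fun i a l p \<le> F_fun i a l (q_plus i a l)"
    unfolding q_plus_def using assms by (intro is_maximizer(2)[where S = "{1..i}"]) auto
  then have "int (F_fun i a l p) \<le> int (F_fun i a l (q_plus i a l))"
    by simp
  then show ?thesis
    using assms sum_split_at(1)[of 1 p i "\<lambda>j. int (a j (l - 1))"]
    by (simp add: eps_row int_F_fun)
qed

lemma eps_column_ge:
  assumes "1 \<le> l" "l < i" "i \<le> p" "p \<le> n"
  shows "(\<Sum>j = i..p. int (a l j)) - (\<Sum>j \<in> {i..<p}. int (a (l + 1) j)) \<le> KR_eps n i m l a"
proof -
  have "G_fun n i a l p \<le> G_fun n i a l (q_minus n i a l)"
    unfolding q_minus_def using assms by (intro is_maximizer(2)[where S = "{i..n}"]) auto
  then have "int (G_fun n i a l p) \<le> int (G_fun n i a l (q_minus n i a l))"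
    by simp
  then show ?thesis
    using assms sum_split_at(2)[of i p n "\<lambda>j. int (a (l + 1) j)"]
    by (simp add: eps_column int_G_fun)
qed

text \<open>
  For \<open>l = i\<close> the bound defining \<open>B\<^sup>i\<^sup>,\<^sup>m\<close> is needed, along the lattice path that runs through the
  whole row \<open>i\<close> first and then through the whole column \<open>i\<close>.
\<close>

lemma phi_nonneg:
  assumes "a \<in> KR_set n i m" "1 \<le> i" "i \<le> n" "1 \<le> l"
  shows "0 \<le> KR_phi n i m l a"
proof (cases l i rule: linorder_cases)
  case less
  have "G_fun n i a l n \<le> G_fun n i a l (p_minus n i a l)"
    unfolding p_minus_def using assms less by (intro is_maximizer(2)[where S = "{i..n}"]) auto
  moreover have "(\<Sum>j = i..n. a l j) \<le> G_fun n i a l n"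
    by (simp add: G_fun_def)
  ultimately have "int (\<Sum>j = i..n. a l j) \<le> int (G_fun n i a l (p_minus n i a l))"
    by linarith
  then show ?thesis
    using assms less by (simp add: phi_column)
next
  case equal
  define \<beta> where "\<beta> = (\<lambda>s. if s \<le> i then (s, i) else (i, s))"
  have "KR_path n i \<beta>"
    using assms by (auto simp: KR_path_def \<beta>_def)
  then have "(\<Sum>s = 1..n. case \<beta> s of (p, q) \<Rightarrow> a p q) \<le> m"
    using assms(1) by (auto simp: KR_set_def)
  then have "(\<Sum>s = 1..n. int (case \<beta> s of (p, q) \<Rightarrow> a p q)) \<le> int m"
    by (simp flip: of_nat_sum)
  moreover have "(\<Sum>s = 1..n. int (case \<beta> s of (p, q) \<Rightarrow> a p q))
      = (\<Sum>s \<in> {1..<i}. int (case \<beta> s of (p, q) \<Rightarrow> a p q))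
        + (\<Sum>s = i..n. int (case \<beta> s of (p, q) \<Rightarrow> a p q))"
    using sum_split_at(2)[of 1 i n "\<lambda>s. int (case \<beta> s of (p, q) \<Rightarrow> a p q)"] assms by simp
  moreover have "(\<Sum>s \<in> {1..<i}. int (case \<beta> s of (p, q) \<Rightarrow> a p q)) = (\<Sum>j \<in> {1..<i}. int (a j i))"
    by (rule sum.cong) (auto simp: \<beta>_def)
  moreover have "(\<Sum>s = i..n. int (case \<beta> s of (p, q) \<Rightarrow> a p q)) = (\<Sum>j = i..n. int (a i j))"
    by (rule sum.cong) (auto simp: \<beta>_def)
  ultimately show ?thesis
    using assms equal by (simp add: KR_phi_def)
next
  case greater
  have "F_fun i a l 1 \<le> F_fun i a l (p_plus i a l)"
    unfolding p_plus_def using assms greater by (intro is_maximizer(2)[where S = "{1..i}"]) auto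
  moreover have "(\<Sum>j = 1..i. a j l) \<le> F_fun i a l 1"
    by (simp add: F_fun_def)
  ultimately have "int (\<Sum>j = 1..i. a j l) \<le> int (F_fun i a l (p_plus i a l))"
    by linarith
  then show ?thesis
    using assms greater by (simp add: phi_row)
qed

section \<open>Highest weight elements live on an antidiagonal\<close>

text \<open>
  The induction runs over the distance of \<open>(p, q)\<close> from the corner \<open>(i, i)\<close>. The row inequality
  bounds \<open>a\<^sub>p\<^sub>,\<^sub>q\<close> by entries \<open>a\<^sub>j\<^sub>,\<^sub>q\<^sub>-\<^sub>1\<close> with \<open>j > p\<close>, so it never leaves the region beyond the
  antidiagonal; the column inequality bounds it by entries \<open>a\<^sub>p\<^sub>+\<^sub>1\<^sub>,\<^sub>j\<close> with \<open>j < q\<close>, so it never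
  leaves the region before it. On either side the inequality that would have index \<open>t\<close>, and hence is
  not available, is never the one required.
\<close>

lemma eps_zero_support:
  assumes eps0: "\<And>l. l \<in> {1..n} \<Longrightarrow> l \<noteq> t \<Longrightarrow> KR_eps n i m l a \<le> 0"
    and "1 \<le> p" "p \<le> i" "i \<le> q" "q \<le> n" "p + q \<noteq> i + t"
  shows "a p q = 0"
  using assms(2-)
proof (induction "q + (i - p)" arbitrary: p q rule: less_induct)
  case less
  note range = less.prems
  have row: "a p q = 0"
    if "i < q" "q \<noteq> t" and z: "\<And>j. j \<in> {p + 1..i} \<Longrightarrow> a j (q - 1) = 0"
  proof -
    have "(\<Sum>j = p..i. int (a j q)) \<le> 0"
      using eps_row_ge[of p i q a n m] eps0[of q] that range by simp
    moreover have "int (a p q) \<le> (\<Sum>j = p..i. int (a j q))"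
      by (rule member_le_sum) (use range in auto)
    ultimately show ?thesis by simp
  qed
  have column: "a p q = 0"
    if "p < i" "p \<noteq> t" and z: "\<And>j. j \<in> {i..<q} \<Longrightarrow> a (p + 1) j = 0"
  proof -
    have "(\<Sum>j = i..q. int (a p j)) \<le> 0"
      using eps_column_ge[of p i q n a m] eps0[of p] that range by simp
    moreover have "int (a p q) \<le> (\<Sum>j = i..q. int (a p j))"
      by (rule member_le_sum) (use range in auto)
    ultimately show ?thesis by simp
  qed
  have corner: "a i i = 0" if "i \<noteq> t"
    using eps0[of i] that range by (simp add: KR_eps_def)
  show ?case
  proof (cases "p + q > i + t")
    case True
    show ?thesis
    proof (cases "q = i")
      case True
      \<comment> \<open>Here \<open>p > t\<close>, and the column inequality has an empty right-hand side.\<close>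
      then show ?thesis
        using corner column \<open>p + q > i + t\<close> range by (cases "p = i") auto
    next
      case False
      show ?thesis
      proof (rule row)
        show "a j (q - 1) = 0" if "j \<in> {p + 1..i}" for j
          by (rule less.hyps) (use that range False \<open>p + q > i + t\<close> in auto)
      qed (use range False \<open>p + q > i + t\<close> in auto)
    qed
  next
    case before: False
    show ?thesis
    proof (cases "p = i")
      case True
      \<comment> \<open>Here \<open>q < t\<close>, and the row inequality has an empty right-hand side.\<close>
      then show ?thesis
        using corner row before range by (cases "q = i") auto
    next
      case False
      show ?thesis
      proof (rule column)
        show "a (p + 1) j = 0" if "j \<in> {i..<q}" for j
          by (rule less.hyps) (use that range False before in auto)
      qed (use range False before in auto)
    qed
  qed
qed

text \<open>
  Written with minimum and maximum, so that the symmetry in \<open>i\<close> and \<open>t\<close> is manifest; the entries in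
  question are \<open>a\<^bsub>min i t - j, max i t + j\<^esub>\<close>.
\<close>

definition antidiagonal :: "nat \<Rightarrow> nat \<Rightarrow> nat \<Rightarrow> arr \<Rightarrow> bool" where
  "antidiagonal n i t a \<longleftrightarrow> (\<forall>p q. a p q \<noteq> 0 \<longrightarrow>
     1 \<le> p \<and> p \<le> min i t \<and> max i t \<le> q \<and> q \<le> n \<and> p + q = i + t)"

lemma antidiagonal_swap: "antidiagonal n i t a \<longleftrightarrow> antidiagonal n t i a"
  by (simp add: antidiagonal_def min.commute max.commute add.commute)

lemma antidiagonal_off:
  assumes "antidiagonal n i t a" "p + q \<noteq> i + t \<or> p = 0 \<or> q < max i t"
  shows "a p q = 0"
proof (rule ccontr)
  assume "a p q \<noteq> 0"
  then have "1 \<le> p \<and> max i t \<le> q \<and> p + q = i + t"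
    using assms(1) by (simp add: antidiagonal_def)
  then show False
    using assms(2) by linarith
qed

lemma KR_set_outside:
  assumes "a \<in> KR_set n i m" "a p q \<noteq> 0"
  shows "1 \<le> p" "p \<le> i" "i \<le> q" "q \<le> n"
proof -
  have "1 \<le> p \<and> p \<le> i \<and> i \<le> q \<and> q \<le> n"
    using assms unfolding KR_set_def mem_Collect_eq by metis
  then show "1 \<le> p" "p \<le> i" "i \<le> q" "q \<le> n"
    by simp_all
qed

lemma antidiagonalI:
  assumes "a \<in> KR_set n i m"
    and "\<And>l. l \<in> {1..n} \<Longrightarrow> l \<noteq> t \<Longrightarrow> KR_eps n i m l a \<le> 0"
  shows "antidiagonal n i t a"
  unfolding antidiagonal_def
proof (intro allI impI)
  fix p q
  assume "a p q \<noteq> 0"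
  note range = KR_set_outside[OF assms(1) this]
  have "p + q = i + t"
  proof (rule ccontr)
    assume "p + q \<noteq> i + t"
    with assms(2) range have "a p q = 0"
      by (rule eps_zero_support)
    with \<open>a p q \<noteq> 0\<close> show False by simp
  qed
  then show "1 \<le> p \<and> p \<le> min i t \<and> max i t \<le> q \<and> q \<le> n \<and> p + q = i + t"
    using range by auto
qed

lemma eps_zero_imp_zero_arr:
  assumes "a \<in> KR_set n i m" "\<And>l. l \<in> {1..n} \<Longrightarrow> KR_eps n i m l a \<le> 0"
  shows "a = zero_arr"
proof -
  have "antidiagonal n i 0 a"
    using assms by (intro antidiagonalI)
  then show ?thesis
    by (fastforce simp: antidiagonal_def zero_arr_def)
qed

lemma antidiagonal_eqI:
  assumes "antidiagonal n i t a" "antidiagonal n i t b"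
    and eq: "\<And>j. j \<le> min i t - 1 \<Longrightarrow> j \<le> n - max i t \<Longrightarrow>
      a (min i t - j) (max i t + j) = b (min i t - j) (max i t + j)"
  shows "a = b"
proof (intro ext)
  fix p q
  show "a p q = b p q"
  proof (cases "a p q = 0 \<and> b p q = 0")
    case False
    then have "1 \<le> p" "p \<le> min i t" "max i t \<le> q" "q \<le> n" "p + q = i + t"
      using assms(1,2) by (auto simp: antidiagonal_def)
    moreover from this have "min i t - (q - max i t) = p"
      by (auto simp: min_def max_def split: if_splits)
    ultimately show ?thesis
      using eq[of "q - max i t"] by auto
  qed simp
qed

section \<open>Cartan pairings\<close>

lemma phi_minus_eps_tensor:
  "phi (B \<otimes>\<^sub>c C) l (b, c) - eps (B \<otimes>\<^sub>c C) l (b, c)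
     = (phi B l b - eps B l b) + (phi C l c - eps C l c)"
  by (simp add: tensor_def max_def)

lemma phi_minus_eps_row:
  assumes "i < l" "1 \<le> i"
  shows "KR_phi n i m l a - KR_eps n i m l a
    = (\<Sum>j = 1..i. int (a j (l - 1))) - (\<Sum>j = 1..i. int (a j l))"
proof -
  \<comment> \<open>The two extremal maximizers may differ, but the maximum is the same.\<close>
  have "F_fun i a l (p_plus i a l) = F_fun i a l (q_plus i a l)"
  proof (rule antisym)
    have "p_plus i a l \<in> {1..i}" "q_plus i a l \<in> {1..i}"
      unfolding p_plus_def q_plus_def using assms by (intro is_maximizer(1); auto)+
    then show "F_fun i a l (p_plus i a l) \<le> F_fun i a l (q_plus i a l)"
      and "F_fun i a l (q_plus i a l) \<le> F_fun i a l (p_plus i a l)"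
      using assms is_maximizer(2)[of "{1..i}"] by (auto simp: p_plus_def q_plus_def)
  qed
  then show ?thesis
    using assms by (simp add: phi_row eps_row)
qed

lemma phi_minus_eps_zero_arr:
  assumes "1 \<le> i" "i \<le> l"
  shows "KR_phi n i m l zero_arr - KR_eps n i m l zero_arr = (if l = i then int m else 0)"
proof (cases "l = i")
  case True
  then show ?thesis
    using assms by (simp add: KR_phi_def KR_eps_def zero_arr_def)
next
  case False
  then show ?thesis
    using assms by (simp add: phi_minus_eps_row zero_arr_def)
qed

lemma antidiagonal_row_sum:
  assumes "antidiagonal n i t a" "max i t \<le> l" "min i t \<le> N"
  shows "(\<Sum>j = 1..N. int (a j l)) = int (a (i + t - l) l)"
proof (cases "i + t - l = 0")
  case True
  then have "a j l = 0" for j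
    using antidiagonal_off[OF assms(1), of j l] True by (cases "j = 0") auto
  then show ?thesis by simp
next
  case False
  have "i + t - l \<in> {1..N}"
    using False assms(2,3) by (auto simp: min_def max_def split: if_splits)
  moreover have "a j l = 0" if "j \<noteq> i + t - l" for j
  proof -
    have "j + l \<noteq> i + t"
      using that by linarith
    then show ?thesis
      using antidiagonal_off[OF assms(1), of j l] by simp
  qed
  ultimately have "(\<Sum>j = 1..N. int (a j l)) = (\<Sum>j \<in> {i + t - l}. int (a j l))"
    by (intro sum.mono_neutral_right) auto
  then show ?thesis by simp
qed

lemma pairing_beyond:
  assumes "antidiagonal n i t a" "1 \<le> i" "1 \<le> t" "max i t < l"
  shows "KR_phi n i m l a - KR_eps n i m l a + (KR_phi n t m' l zero_arr - KR_eps n t m' l zero_arr)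
    = int (a (i + t - (l - 1)) (l - 1)) - int (a (i + t - l) l)"
proof -
  have "KR_phi n i m l a - KR_eps n i m l a
      = (\<Sum>j = 1..i. int (a j (l - 1))) - (\<Sum>j = 1..i. int (a j l))"
    using assms by (intro phi_minus_eps_row) auto
  moreover have "KR_phi n t m' l zero_arr - KR_eps n t m' l zero_arr = 0"
    using assms by (subst phi_minus_eps_zero_arr) auto
  moreover have "max i t \<le> l - 1" "max i t \<le> l" "min i t \<le> i"
    using assms(4) by auto
  ultimately show ?thesis
    using antidiagonal_row_sum[OF assms(1)] by simp
qed

text \<open>
  At \<open>l = max i t\<close> the factor whose rectangle starts in row \<open>l\<close> contributes the multiple of the
  fundamental weight, and the antidiagonal entry is the one at the corner \<open>(min i t, max i t)\<close>.
  For \<open>i = t\<close> this entry sits at \<open>(i, i)\<close> and is counted twice.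
\<close>

lemma pairing_top:
  assumes "antidiagonal n i t a" "1 \<le> i" "i \<le> n" "1 \<le> t" "t \<le> n" "l = max i t"
  shows "KR_phi n i m l a - KR_eps n i m l a + (KR_phi n t m' l zero_arr - KR_eps n t m' l zero_arr)
    = (if l = i then int m else 0) + (if l = t then int m' else 0)
      - (if i = t then 2 else 1) * int (a (min i t) l)"
proof (cases "i < t")
  case True
  have "a j (t - 1) = 0" for j
    using antidiagonal_off[OF assms(1), of j "t - 1"] True by simp
  then show ?thesis
    using assms True antidiagonal_row_sum[OF assms(1), of t i]
    by (simp add: phi_minus_eps_row phi_minus_eps_zero_arr)
next
  case False
  have off: "a i j = 0" if "j \<noteq> t" for j
    using antidiagonal_off[OF assms(1), of i j] that by simp
  have column: "(\<Sum>j = i..n. int (a i j)) = (if i = t then int (a i i) else 0)"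
  proof -
    have "(\<Sum>j = i..n. int (a i j)) = (\<Sum>j = i..n. if j = t then int (a i t) else 0)"
      using off by (intro sum.cong) auto
    then show ?thesis
      using assms False by auto
  qed
  have row: "(\<Sum>j \<in> {1..<i}. int (a j i)) = (if i = t then 0 else int (a t i))"
  proof (cases "i = t")
    case True
    have "a j i = 0" if "j < i" for j
      using antidiagonal_off[OF assms(1), of j i] that True by simp
    then show ?thesis using True by simp
  next
    case False
    have "{1..<i} = {1..i - 1}"
      using assms(2) by auto
    moreover have "min i t \<le> i - 1" "max i t \<le> i"
      using False \<open>\<not> i < t\<close> by auto
    ultimately show ?thesis
      using False antidiagonal_row_sum[OF assms(1), of i "i - 1"] by simp
  qed
  have "a i i = 0" if "i \<noteq> t"
    using off that by simp
  then show ?thesis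
    using assms False row column
    by (auto simp: KR_phi_def[of n i] KR_eps_def[of n i] phi_minus_eps_zero_arr max_def min_def)
qed

text \<open>
  The pairing at the top fixes the first antidiagonal entry, and each further pairing fixes the next
  one from its predecessor.
\<close>

lemma antidiagonal_entries_determined:
  assumes a: "antidiagonal n i t a" and b: "antidiagonal n i t b"
    and range: "1 \<le> i" "i \<le> n" "1 \<le> t" "t \<le> n"
    and pairing: "\<And>l. l \<in> {1..n} \<Longrightarrow>
      KR_phi n i m l a - KR_eps n i m l a + (KR_phi n t m' l zero_arr - KR_eps n t m' l zero_arr)
      = KR_phi n t m' l b - KR_eps n t m' l b + (KR_phi n i m l zero_arr - KR_eps n i m l zero_arr)"
    and "l \<in> {max i t..n}"
  shows "a (i + t - l) l = b (i + t - l) l"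
proof -
  have b': "antidiagonal n t i b"
    using b antidiagonal_swap by blast
  have "max i t \<le> l" "l \<le> n"
    using assms(8) by auto
  then show ?thesis
  proof (induction l rule: dec_induct)
    case base
    have "i + t - max i t = min i t"
      by auto
    then show ?case
      using pairing[of "max i t"] pairing_top[OF a, of "max i t" m m']
        pairing_top[OF b', of "max i t" m' m] range
      by (cases i t rule: linorder_cases) (simp_all add: max_def min_def)
  next
    case (step l)
    have "int (a (i + t - l) l) - int (a (i + t - Suc l) (Suc l))
        = int (b (i + t - l) l) - int (b (i + t - Suc l) (Suc l))"
      using pairing[of "Suc l"] pairing_beyond[OF a, of "Suc l" m m']
        pairing_beyond[OF b', of "Suc l" m' m] range step
      by (simp add: add.commute max.commute)
    then show ?case
      using step by simp
  qed
qed

section \<open>Tensor products\<close>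

text \<open>
  Since \<open>\<phi>\<^sub>l(b) \<ge> 0\<close>, the case \<open>\<epsilon>\<^sub>l(a) > \<phi>\<^sub>l(b)\<close> would let the raising operator act on \<open>a\<close> with
  \<open>\<epsilon>\<^sub>l(a) > 0\<close>, that is, without annihilating it. So the operator acts on \<open>b\<close>, for every \<open>l\<close>.
\<close>

lemma highest_weight_tensorD:
  assumes "classical_highest_weight n (KR_crystal n i m \<otimes>\<^sub>c KR_crystal n t m') (a, b)"
    and "1 \<le> i" "i \<le> n" "1 \<le> t" "t \<le> n"
  shows "b = zero_arr" and "antidiagonal n i t a"
proof -
  have a: "a \<in> KR_set n i m" and b: "b \<in> KR_set n t m'"
    using assms(1) by (auto simp: classical_highest_weight_def tensor_def KR_crystal_def)
  have eps: "KR_eps n t m' l b = 0 \<and> KR_eps n i m l a \<le> KR_phi n t m' l b" if "l \<in> {1..n}" for l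
  proof -
    have none: "kash_e (KR_crystal n i m \<otimes>\<^sub>c KR_crystal n t m') l (a, b) = None"
      using assms(1) that by (simp add: classical_highest_weight_def)
    have "0 \<le> KR_phi n t m' l b"
      using phi_nonneg[OF b] assms that by simp
    then show ?thesis
      using none by (auto simp: tensor_def KR_crystal_def KR_e_def split: if_splits)
  qed
  show "b = zero_arr"
    using b eps by (intro eps_zero_imp_zero_arr) auto
  have "KR_eps n i m l a \<le> 0" if l: "l \<in> {1..n}" "l \<noteq> t" for l
  proof -
    have "KR_phi n t m' l zero_arr = 0"
      using l by (simp add: KR_phi_def zero_arr_def)
    then show ?thesis
      using eps[OF l(1)] \<open>b = zero_arr\<close> by simp
  qed
  then show "antidiagonal n i t a"
    using a by (intro antidiagonalI)
qed

lemma iso_highest_weight: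
  assumes "affine_crystal_iso n B C \<sigma>" "classical_highest_weight n B b"
  shows "classical_highest_weight n C (\<sigma> b)"
  using assms by (auto simp: affine_crystal_iso_def classical_highest_weight_def bij_betw_def)

theorem theorem4p1:
  fixes n r1 r2 s1 s2 r rt k :: nat
    and \<sigma> :: "arr \<times> arr \<Rightarrow> arr \<times> arr"
    and A B At Bt :: arr
  assumes "n \<ge> 1"
    and "1 \<le> r1" "r1 \<le> n" "1 \<le> r2" "r2 \<le> n" "s1 \<ge> 1" "s2 \<ge> 1"
    and "r = min r1 r2" "rt = max r1 r2" "k = min (r - 1) (n - rt)"
    and "combinatorial_R n r1 s1 r2 s2 \<sigma>"
    and "classical_highest_weight n (KR_crystal n r1 s1 \<otimes>\<^sub>c KR_crystal n r2 s2) (A, B)"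
    and "\<sigma> (A, B) = (At, Bt)"
  shows "classical_highest_weight n (KR_crystal n r2 s2 \<otimes>\<^sub>c KR_crystal n r1 s1) (At, Bt) \<and>
         Bt = zero_arr \<and>
         (\<forall>j \<in> {0..k}. At (r - j) (rt + j) = A (r - j) (rt + j)) \<and>
         (\<forall>X Y. classical_highest_weight n (KR_crystal n r2 s2 \<otimes>\<^sub>c KR_crystal n r1 s1) (X, Y) \<and>
                Y = zero_arr \<and>
                (\<forall>j \<in> {0..k}. X (r - j) (rt + j) = A (r - j) (rt + j))
            \<longrightarrow> X = At \<and> Y = Bt)"
proof -
  note r_range = assms(2-5)
  let ?B = "KR_crystal n r1 s1 \<otimes>\<^sub>c KR_crystal n r2 s2"
  let ?C = "KR_crystal n r2 s2 \<otimes>\<^sub>c KR_crystal n r1 s1"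
  have iso: "affine_crystal_iso n ?B ?C \<sigma>"
    using assms(11) by (simp add: combinatorial_R_def)
  have hwt: "classical_highest_weight n ?C (At, Bt)"
    using iso_highest_weight[OF iso assms(12)] assms(13) by simp
  have B: "B = zero_arr" and A: "antidiagonal n r1 r2 A"
    using highest_weight_tensorD[OF assms(12)] r_range by blast+
  have target: "Y = zero_arr" "antidiagonal n r1 r2 X"
    if "classical_highest_weight n ?C (X, Y)" for X Y
    using highest_weight_tensorD[OF that] r_range antidiagonal_swap by blast+
  have Bt: "Bt = zero_arr" and At: "antidiagonal n r1 r2 At"
    using target[OF hwt] by blast+
  have "(A, B) \<in> elems ?B"
    using assms(12) by (simp add: classical_highest_weight_def)
  then have preserved: "phi ?C l (At, Bt) - eps ?C l (At, Bt) = phi ?B l (A, B) - eps ?B l (A, B)"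
    if "l \<in> {1..n}" for l
    using iso assms(13) that unfolding affine_crystal_iso_def by fastforce
  have "A (r1 + r2 - l) l = At (r1 + r2 - l) l" if "l \<in> {rt..n}" for l
  proof (rule antidiagonal_entries_determined[OF A At r_range])
    show "KR_phi n r1 s1 l A - KR_eps n r1 s1 l A
        + (KR_phi n r2 s2 l zero_arr - KR_eps n r2 s2 l zero_arr)
      = KR_phi n r2 s2 l At - KR_eps n r2 s2 l At
        + (KR_phi n r1 s1 l zero_arr - KR_eps n r1 s1 l zero_arr)" if "l \<in> {1..n}" for l
      using preserved[OF that] B Bt unfolding phi_minus_eps_tensor by (simp add: KR_crystal_def)
  qed (use that assms(9) in auto)
  moreover have "r1 + r2 - (rt + j) = r - j" for j
    using assms(8,9) by auto
  moreover have "rt + j \<in> {rt..n}" if "j \<in> {0..k}" for j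
    using that assms(9,10) r_range by auto
  ultimately have entries: "\<forall>j \<in> {0..k}. At (r - j) (rt + j) = A (r - j) (rt + j)"
    by metis
  have "X = At \<and> Y = Bt"
    if X: "classical_highest_weight n ?C (X, Y)"
      and eq: "\<forall>j \<in> {0..k}. X (r - j) (rt + j) = A (r - j) (rt + j)" for X Y
  proof
    show "X = At"
      using target(2)[OF X] At
    proof (rule antidiagonal_eqI)
      fix j
      assume "j \<le> min r1 r2 - 1" "j \<le> n - max r1 r2"
      then have "j \<in> {0..k}"
        unfolding assms(8-10) by simp
      then show "X (min r1 r2 - j) (max r1 r2 + j) = At (min r1 r2 - j) (max r1 r2 + j)"
        using eq entries unfolding assms(8,9) by simp
    qed
    show "Y = Bt"
      using target(1)[OF X] Bt by simp
  qed
  then show ?thesis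
    using hwt Bt entries by blast
qed

end
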